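(* Let $q,s$ be nonzero real numbers with $q\ge 2$, and let $(c_n)_{n\ge 0}$ be defined by $c_0=0$, $c_1=s$ and $$c_{n+1}=q\,c_n-c_{n-1}+s\qquad (n\ge 1).$$ Suppose that $s>\tfrac12$ and that $$0\le (q-s)\,c_n-2c_{n-1}+s-1\qquad\text{for every positive integer } n.$$ Then for every positive integer $n$, $$\left\lfloor\left(\sum_{k=n}^{\infty}\frac{1}{c_k}\right)^{-1}\right\rfloor=c_n-c_{n-1}-1.$$
   Context: $\lfloor x\rfloor$ denotes the greatest integer at most $x$.
   Formalization: The floor identity is asserted only for n with c_n-c_{n-1}-1 an integer (it fails otherwise, e.g. q=5, s=7/10, n=1); for all real q, s it is proved that the series converges and c_n-c_{n-1}-1 <= (sum)^{-1} < c_n-c_{n-1}. *)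

theory Defs
  imports Complex_Main
begin

text \<open>
  The sum \<open>\<Sum>k\<ge>n. 1 / c k\<close> is written \<open>\<Sum>k. 1 / c (n + k)\<close>.

  For real \<open>q\<close> and \<open>s\<close> the number \<open>c n - c (n - 1) - 1\<close> need not be an integer, and then
  it cannot be the value of a floor: \<open>q = 5\<close>, \<open>s = 7/10\<close> satisfy all hypotheses, but for
  \<open>n = 1\<close> the right-hand side is \<open>-3/10\<close>. The floor identity is therefore stated for those \<open>n\<close>
  for which the right-hand side is an integer. For all real \<open>q\<close> and \<open>s\<close> the defining
  inequalities of the floor, \<open>c n - c (n - 1) - 1 \<le> x < c n - c (n - 1)\<close>, are stated
  unconditionally. When the right-hand side is an integer, they are equivalent to the identity.
\<close>

end

theory Submission
  imports Defs
begin

text \<open>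
  Write \<open>d n = c n - c (n - 1)\<close>. The quadratic form
  \<open>c (n + 1)\<^sup>2 + c n\<^sup>2 - q * c (n + 1) * c n - s * (c (n + 1) + c n)\<close> is an invariant of the
  recurrence, and it vanishes for \<open>c 0 = 0\<close>, \<open>c 1 = s\<close>. This gives
  \<open>d n * d (n + 1) = c n * (d (n + 1) - d n + s)\<close>, so that \<open>1 / c n\<close> exceeds the telescoping term
  \<open>1 / d n - 1 / d (n + 1)\<close> because \<open>s > 0\<close>, while \<open>1 / c n \<le> 1 / (d n - 1) - 1 / (d (n + 1) - 1)\<close>
  amounts to the hypothesis \<open>0 \<le> (q - s) * c n - 2 * c (n - 1) + s - 1\<close>.
\<close>

locale affine_recurrence =
  fixes q s :: real and c :: "nat \<Rightarrow> real"
  assumes q_ge_2: "q \<ge> 2" and s_pos: "s > 0"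
    and c_0: "c 0 = 0" and c_1: "c (Suc 0) = s"
    and c_rec: "c (Suc (Suc n)) = q * c (Suc n) - c n + s"
begin

text \<open>Truncated subtraction makes \<open>d 0 = 0\<close>, hence the condition
  \<open>n \<ge> 1\<close> in the lemmas that divide by \<open>d n\<close>.\<close>

definition d :: "nat \<Rightarrow> real" where
  "d n = c n - c (n - 1)"

lemma d_Suc: "d (Suc n) = c (Suc n) - c n"
  by (simp add: d_def)

lemma d_step: "d (Suc (Suc n)) - d (Suc n) = (q - 2) * c (Suc n) + s"
  by (simp add: d_Suc c_rec algebra_simps)

text \<open>The two claims need each other: \<open>c n \<ge> 0\<close> makes \<open>d\<close> grow
  by at least \<open>s\<close> per step, and positive differences keep \<open>c\<close> nonnegative.
  The linear bound later gives both positivity and divergence of \<open>d\<close>.\<close>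

lemma growth: "0 \<le> c n \<and> real (Suc n) * s \<le> d (Suc n)"
proof (induction n)
  case 0
  then show ?case by (simp add: d_Suc c_0 c_1)
next
  case (Suc n)
  have "0 \<le> real (Suc n) * s" using s_pos by simp
  with Suc have c: "0 \<le> c (Suc n)" using d_Suc[of n] by linarith
  then have "0 \<le> (q - 2) * c (Suc n)" using q_ge_2 by simp
  with Suc have "real (Suc n) * s + s \<le> d (Suc (Suc n))"
    using d_step[of n] by linarith
  with c show ?case by (simp add: algebra_simps)
qed

lemma c_nonneg: "0 \<le> c n"
  using growth by blast

lemma d_pos: assumes "n \<ge> 1" shows "0 < d n"
proof -
  obtain m where n: "n = Suc m" using assms not0_implies_Suc by fastforce
  have "0 < real (Suc m) * s" using s_pos by simp
  also have "\<dots> \<le> d n" using growth[of m] unfolding n by blast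
  finally show ?thesis .
qed

lemma c_pos: assumes "n \<ge> 1" shows "0 < c n"
  using d_pos[OF assms] c_nonneg[of "n - 1"] by (simp add: d_def)

lemma d_increment: assumes "n \<ge> 1" shows "s \<le> d (Suc n) - d n"
proof -
  obtain m where "n = Suc m" using assms not0_implies_Suc by fastforce
  then show ?thesis using d_step[of m] c_nonneg[of n] q_ge_2 by simp
qed

lemma filterlim_d: "filterlim d at_top sequentially"
proof -
  have "filterlim (\<lambda>n. s * real (Suc n)) at_top sequentially"
    by (intro filterlim_tendsto_pos_mult_at_top[OF tendsto_const s_pos]
        filterlim_compose[OF filterlim_real_sequentially filterlim_Suc])
  then have "filterlim (\<lambda>n. d (Suc n)) at_top sequentially"
    by (rule filterlim_at_top_mono) (use growth in \<open>auto simp: mult.commute\<close>)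
  then show ?thesis by (simp add: filterlim_sequentially_Suc)
qed

text \<open>By Vieta: for fixed \<open>y = c (Suc n)\<close>, the quadratic
  \<open>x\<^sup>2 + y\<^sup>2 - q * x * y - s * (x + y)\<close> in \<open>x\<close> takes equal
  values at two points with sum \<open>q * y + s\<close>, and the recurrence says that
  \<open>c n\<close> and \<open>c (Suc (Suc n))\<close> are such points.\<close>

lemma invariant:
  "(c (Suc n))\<^sup>2 + (c n)\<^sup>2 - q * c (Suc n) * c n = s * (c (Suc n) + c n)"
proof (induction n)
  case 0
  then show ?case by (simp add: c_0 c_1 power2_eq_square)
next
  case (Suc n)
  have "(c (Suc (Suc n)))\<^sup>2 + (c (Suc n))\<^sup>2 - q * c (Suc (Suc n)) * c (Suc n)
      - s * (c (Suc (Suc n)) + c (Suc n))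
    = (c (Suc n))\<^sup>2 + (c n)\<^sup>2 - q * c (Suc n) * c n - s * (c (Suc n) + c n)"
    unfolding c_rec by (simp add: algebra_simps power2_eq_square)
  with Suc show ?case by simp
qed

lemma d_mult_d:
  assumes "n \<ge> 1"
  shows "d n * d (Suc n) = c n * (d (Suc n) - d n + s)"
proof -
  obtain m where n: "n = Suc m" using assms not0_implies_Suc by fastforce
  \<comment> \<open>Once the recurrence eliminates \<open>c (Suc n)\<close>, the difference of the
    two sides is the invariant form at \<open>m\<close>.\<close>
  have "d n * d (Suc n) - c n * (d (Suc n) - d n + s)
    = (c (Suc m))\<^sup>2 + (c m)\<^sup>2 - q * c (Suc m) * c m - s * (c (Suc m) + c m)"
    unfolding n d_Suc c_rec by (simp add: algebra_simps power2_eq_square)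
  then show ?thesis using invariant[of m] by simp
qed

lemma inverse_d_telescope:
  assumes "n \<ge> 1"
  shows "1 / d n - 1 / d (Suc n) = (d (Suc n) - d n) / (c n * (d (Suc n) - d n + s))"
proof -
  have "d n \<noteq> 0" "d (Suc n) \<noteq> 0"
    using d_pos[of n] d_pos[of "Suc n"] assms by simp_all
  then have "1 / d n - 1 / d (Suc n) = (d (Suc n) - d n) / (d n * d (Suc n))"
    by (simp add: diff_frac_eq)
  then show ?thesis unfolding d_mult_d[OF assms] .
qed

lemma telescope_less:
  assumes "n \<ge> 1"
  shows "1 / d n - 1 / d (Suc n) < 1 / c n"
proof -
  define D where "D = d (Suc n) - d n"
  have "D / (D + s) < 1"
    using d_increment[OF assms] s_pos by (simp add: D_def)
  then have "D / (D + s) / c n < 1 / c n"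
    using c_pos[OF assms] by (rule divide_strict_right_mono)
  then show ?thesis
    unfolding inverse_d_telescope[OF assms] D_def by (simp add: mult.commute)
qed

text \<open>Since \<open>s \<le> D\<close>, the ratio \<open>D / (D + s)\<close> is at least 1/2,
  whence the factor 2. This crude bound serves as a summable majorant.\<close>

lemma inverse_c_le_telescope:
  assumes "n \<ge> 1"
  shows "1 / c n \<le> 2 * (1 / d n - 1 / d (Suc n))"
proof -
  define D where "D = d (Suc n) - d n"
  have "s \<le> D" using d_increment[OF assms] by (simp add: D_def)
  then have "1 \<le> 2 * D / (D + s)" using s_pos by simp
  then have "1 / c n \<le> 2 * D / (D + s) / c n"
    using c_nonneg by (rule divide_right_mono)
  then show ?thesis
    unfolding inverse_d_telescope[OF assms] D_def by (simp add: mult.commute)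
qed

text \<open>The shift \<open>t = 0\<close> serves summability and the lower bound of the sum,
  \<open>t = 1\<close> the upper bound.\<close>

lemma telescope_sums:
  assumes "n \<ge> 1"
  shows "(\<lambda>k. 1 / (d (n + k) - t) - 1 / (d (Suc (n + k)) - t)) sums (1 / (d n - t))"
proof -
  have "filterlim (\<lambda>k. - t + d (k + n)) at_top sequentially"
    by (intro filterlim_tendsto_add_at_top[OF tendsto_const]
        filterlim_compose[OF filterlim_d filterlim_add_const_nat_at_top])
  then have "(\<lambda>k. inverse (- t + d (k + n))) \<longlonglongrightarrow> 0"
    by (rule tendsto_inverse_0_at_top)
  then have "(\<lambda>k. 1 / (d (n + k) - t)) \<longlonglongrightarrow> 0"
    by (simp add: inverse_eq_divide add.commute)
  from telescope_sums'[OF this] show ?thesis by simp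
qed

lemma summable_inverse_c:
  assumes "n \<ge> 1"
  shows "summable (\<lambda>k. 1 / c (n + k))"
proof (rule summable_comparison_test')
  show "summable (\<lambda>k. 2 * (1 / d (n + k) - 1 / d (Suc (n + k))))"
    using sums_summable[OF telescope_sums[OF assms, of 0]] by (intro summable_mult) simp
  show "norm (1 / c (n + k)) \<le> 2 * (1 / d (n + k) - 1 / d (Suc (n + k)))" if "k \<ge> 0" for k
    using inverse_c_le_telescope[of "n + k"] c_pos[of "n + k"] assms by simp
qed

lemma suminf_inverse_c_greater:
  assumes "n \<ge> 1"
  shows "1 / d n < (\<Sum>k. 1 / c (n + k))"
proof -
  have "(\<lambda>k. 1 / d (n + k) - 1 / d (Suc (n + k))) sums (1 / d n)"
    using telescope_sums[OF assms, of 0] by simp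
  with summable_sums[OF summable_inverse_c[OF assms]]
  have "(\<lambda>k. 1 / c (n + k) - (1 / d (n + k) - 1 / d (Suc (n + k)))) sums
    ((\<Sum>k. 1 / c (n + k)) - 1 / d n)"
    by (rule sums_diff)
  \<comment> \<open>Positivity of every term keeps the inequality strict in the limit.\<close>
  moreover have "0 < 1 / c (n + k) - (1 / d (n + k) - 1 / d (Suc (n + k)))" for k
    using telescope_less[of "n + k"] assms by simp
  ultimately have "0 < (\<Sum>k. 1 / c (n + k)) - 1 / d n"
    using suminf_pos[OF sums_summable] sums_unique by fastforce
  then show ?thesis by simp
qed

lemma inverse_c_le_shifted_telescope:
  assumes "n \<ge> 1" and "d n > 1"
    and hyp: "0 \<le> (q - s) * c n - 2 * c (n - 1) + s - 1"
  shows "1 / c n \<le> 1 / (d n - 1) - 1 / (d (Suc n) - 1)"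
proof -
  obtain m where n: "n = Suc m" using assms(1) not0_implies_Suc by fastforce
  have gt: "d (Suc n) > 1"
    using d_increment[OF assms(1)] s_pos assms(2) by linarith
  have "(d n - 1) * (d (Suc n) - 1) = d n * d (Suc n) - (d n + d (Suc n)) + 1"
    by (simp add: algebra_simps)
  \<comment> \<open>The sum \<open>d n + d (Suc n)\<close> collapses to
    \<open>c (Suc n) - c (n - 1) = q * c n - 2 * c (n - 1) + s\<close>; with \<open>s * c n\<close>
    from \<open>d_mult_d\<close> this leaves exactly the expression in \<open>hyp\<close>.\<close>
  also have "\<dots> = c n * (d (Suc n) - d n) - ((q - s) * c n - 2 * c (n - 1) + s - 1)"
    unfolding d_mult_d[OF assms(1)] by (simp add: n d_Suc c_rec algebra_simps)
  also have "\<dots> \<le> c n * (d (Suc n) - d n)" using hyp by simp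
  finally have "(d n - 1) * (d (Suc n) - 1) \<le> c n * (d (Suc n) - d n)" .
  then have "1 / c n \<le> (d (Suc n) - d n) / ((d n - 1) * (d (Suc n) - 1))"
    using c_pos[OF assms(1)] gt assms(2)
    by (simp add: divide_simps mult.commute mult.left_commute)
  also have "\<dots> = 1 / (d n - 1) - 1 / (d (Suc n) - 1)"
    using gt assms(2) by (simp add: diff_frac_eq)
  finally show ?thesis .
qed

lemma suminf_inverse_c_le:
  assumes "n \<ge> 1" and "d n > 1"
    and hyp: "\<And>n. n \<ge> 1 \<Longrightarrow> 0 \<le> (q - s) * c n - 2 * c (n - 1) + s - 1"
  shows "(\<Sum>k. 1 / c (n + k)) \<le> 1 / (d n - 1)"
proof -
  \<comment> \<open>As \<open>d\<close> increases, all later shifted denominators stay positive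
    too.\<close>
  have gt: "d (n + k) > 1" for k
  proof (induction k)
    case (Suc k)
    then show ?case using d_increment[of "n + k"] assms(1) s_pos by simp
  qed (use assms in simp)
  show ?thesis
    using summable_sums[OF summable_inverse_c[OF assms(1)]] telescope_sums[OF assms(1), of 1]
    by (rule sums_le[rotated])
      (use gt assms(1) in \<open>intro inverse_c_le_shifted_telescope hyp; simp\<close>)
qed

end

theorem theorem1p6:
  fixes q s :: real and c :: "nat \<Rightarrow> real"
  assumes "q \<noteq> 0" and "s \<noteq> 0" and "q \<ge> 2"
    and "c 0 = 0" and "c 1 = s"
    and "\<And>n. n \<ge> 1 \<Longrightarrow> c (n + 1) = q * c n - c (n - 1) + s"
    and "s > 1 / 2"
    and "\<And>n. n \<ge> 1 \<Longrightarrow> 0 \<le> (q - s) * c n - 2 * c (n - 1) + s - 1"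
  shows "\<forall>n\<ge>1. summable (\<lambda>k. 1 / c (n + k)) \<and>
    c n - c (n - 1) - 1 \<le> inverse (\<Sum>k. 1 / c (n + k)) \<and>
    inverse (\<Sum>k. 1 / c (n + k)) < (c n - c (n - 1) - 1) + 1 \<and>
    (c n - c (n - 1) - 1 \<in> \<int> \<longrightarrow>
      of_int \<lfloor>inverse (\<Sum>k. 1 / c (n + k))\<rfloor> = c n - c (n - 1) - 1)"
proof (intro allI impI)
  fix n :: nat
  assume n: "n \<ge> 1"
  interpret affine_recurrence q s c
    using assms(3-5,7) assms(6)[of "Suc _"] by unfold_locales auto
  define S where "S = (\<Sum>k. 1 / c (n + k))"
  have less: "1 / d n < S"
    unfolding S_def by (rule suminf_inverse_c_greater[OF n])
  have S_pos: "0 < S"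
    using less d_pos[OF n] by (meson divide_pos_pos less_trans zero_less_one)
  have upper: "inverse S < d n"
    using less S_pos d_pos[OF n] by (simp add: field_simps)
  have lower: "d n - 1 \<le> inverse S"
  proof (cases "d n > 1")
    case True
    then have "S \<le> 1 / (d n - 1)"
      unfolding S_def using assms(8) by (intro suminf_inverse_c_le n)
    with True S_pos show ?thesis by (simp add: field_simps)
  next
    \<comment> \<open>Here \<open>d n - 1 \<le> 0 < inverse S\<close>. The case does occur, as
      \<open>d 1 = s\<close> may be at most 1.\<close>
    case False
    with S_pos show ?thesis by (smt (verit) inverse_positive_iff_positive)
  qed
  have floor: "of_int \<lfloor>inverse S\<rfloor> = d n - 1" if "d n - 1 \<in> \<int>"
  proof -
    from that obtain z where z: "d n - 1 = of_int z" by (rule Ints_cases)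
    with lower upper have "\<lfloor>inverse S\<rfloor> = z" by (intro floor_unique) linarith+
    with z show ?thesis by simp
  qed
  show "summable (\<lambda>k. 1 / c (n + k)) \<and>
    c n - c (n - 1) - 1 \<le> inverse (\<Sum>k. 1 / c (n + k)) \<and>
    inverse (\<Sum>k. 1 / c (n + k)) < (c n - c (n - 1) - 1) + 1 \<and>
    (c n - c (n - 1) - 1 \<in> \<int> \<longrightarrow>
      of_int \<lfloor>inverse (\<Sum>k. 1 / c (n + k))\<rfloor> = c n - c (n - 1) - 1)"
    using summable_inverse_c[OF n] lower upper floor unfolding S_def d_def by simp
qed

end
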